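(* The function $\mathrm{DISJ} \colon 2^{\mathbb{N}} \times 2^{\mathbb{N}} \to \{0,1\}$ defined by $\mathrm{DISJ}(x,y) = 1$ if and only if $x_i \wedge y_i = 0$ for all $i \in \mathbb{N}$ has no communication protocol.
   Context: Infinite communication protocols. Let $X = Y = 2^{\mathbb{N}}$ (infinite binary strings) and let $Z$ be a countable set. A protocol $P$ is a countable, well-founded (no infinite branch) rooted tree in which each internal node $v$ is labeled either by a function $a_v \colon X \to \mathbb{N}$ (Alice's node) or by a function $b_v \colon Y \to \mathbb{N}$ (Bob's node), these functions being arbitrary, and each leaf is labeled by an element of $Z$. Every edge is labeled with some natural number, and for each internal node $v$ and each $n$ in the range of $a_v$ (resp. $b_v$), exactly one edge from $v$ to one of its children is labeled $n$. The protocol computes a function $P \colon X \times Y \to Z$: on input $(x,y)$ start at the root; at an internal node $v$ follow the edge labeled $a_v(x)$ (if $v$ is Alice's) or $b_v(y)$ (if $v$ is Bob's); output the label of the leaf eventually reached. A function $f \colon X \times Y \to Z$ has a communication protocol if some protocol computes $f$. *)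

theory Defs
  imports Main "HOL-Library.Countable_Set"
begin

text \<open>
  Infinite binary strings are functions of type \<open>nat \<Rightarrow> bool\<close>, and the two-element
  set of outputs is \<open>bool\<close>, with \<open>True\<close> for 1 and \<open>False\<close> for 0.
\<close>

datatype ('x, 'y, 'z) node_label =
    Alice "'x \<Rightarrow> nat"
  | Bob "'y \<Rightarrow> nat"
  | Output 'z

text \<open>Edges are directed from parent to child; labels off the tree are irrelevant.\<close>

record ('v, 'x, 'y, 'z) protocol =
  nodes :: "'v set"
  edges :: "('v \<times> 'v) set"
  root_node :: 'v
  node_lab :: "'v \<Rightarrow> ('x, 'y, 'z) node_label"
  edge_lab :: "'v \<times> 'v \<Rightarrow> nat"

definition rooted_tree :: "'v set \<Rightarrow> ('v \<times> 'v) set \<Rightarrow> 'v \<Rightarrow> bool" where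
  "rooted_tree V E r \<longleftrightarrow>
     r \<in> V \<and> E \<subseteq> V \<times> V \<and>
     (\<forall>u. (u, r) \<notin> E) \<and>
     (\<forall>v\<in>V - {r}. \<exists>!u. (u, v) \<in> E) \<and>
     (\<forall>v\<in>V. (r, v) \<in> E\<^sup>*)"

definition infinite_branch :: "('v \<times> 'v) set \<Rightarrow> 'v \<Rightarrow> (nat \<Rightarrow> 'v) \<Rightarrow> bool" where
  "infinite_branch E r p \<longleftrightarrow> p 0 = r \<and> (\<forall>i. (p i, p (Suc i)) \<in> E)"

definition is_leaf :: "('v, 'x, 'y, 'z) protocol \<Rightarrow> 'v \<Rightarrow> bool" where
  "is_leaf P v \<longleftrightarrow> v \<in> nodes P \<and> (\<forall>w. (v, w) \<notin> edges P)"

definition unique_edge :: "('v, 'x, 'y, 'z) protocol \<Rightarrow> 'v \<Rightarrow> nat \<Rightarrow> bool" where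
  "unique_edge P v n \<longleftrightarrow> (\<exists>!w. (v, w) \<in> edges P \<and> edge_lab P (v, w) = n)"

definition is_protocol :: "('v, 'x, 'y, 'z::countable) protocol \<Rightarrow> bool" where
  "is_protocol P \<longleftrightarrow>
     rooted_tree (nodes P) (edges P) (root_node P) \<and>
     countable (nodes P) \<and>
     (\<nexists>p. infinite_branch (edges P) (root_node P) p) \<and>
     (\<forall>v\<in>nodes P.
        case node_lab P v of
          Alice a \<Rightarrow> \<not> is_leaf P v \<and> (\<forall>n\<in>range a. unique_edge P v n)
        | Bob b \<Rightarrow> \<not> is_leaf P v \<and> (\<forall>n\<in>range b. unique_edge P v n)
        | Output z \<Rightarrow> is_leaf P v)"

inductive outputs_from ::
  "('v, 'x, 'y, 'z) protocol \<Rightarrow> 'x \<Rightarrow> 'y \<Rightarrow> 'v \<Rightarrow> 'z \<Rightarrow> bool"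
  for P x y where
  leaf: "node_lab P v = Output z \<Longrightarrow> outputs_from P x y v z"
| alice: "node_lab P v = Alice a \<Longrightarrow> (v, w) \<in> edges P \<Longrightarrow> edge_lab P (v, w) = a x \<Longrightarrow>
    outputs_from P x y w z \<Longrightarrow> outputs_from P x y v z"
| bob: "node_lab P v = Bob b \<Longrightarrow> (v, w) \<in> edges P \<Longrightarrow> edge_lab P (v, w) = b y \<Longrightarrow>
    outputs_from P x y w z \<Longrightarrow> outputs_from P x y v z"

definition protocol_fun :: "('v, 'x, 'y, 'z) protocol \<Rightarrow> 'x \<Rightarrow> 'y \<Rightarrow> 'z" where
  "protocol_fun P x y = (THE z. outputs_from P x y (root_node P) z)"

text \<open>The description in \<^const>\<open>protocol_fun\<close> is well defined on protocols.\<close>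

lemma outputs_from_unique:
  assumes P: "is_protocol P"
  shows "outputs_from P x y v z \<Longrightarrow> v \<in> nodes P \<Longrightarrow> outputs_from P x y v z' \<Longrightarrow> z' = z"
proof (induction arbitrary: z' rule: outputs_from.induct)
  case (leaf v z)
  from leaf(3,1) show ?case by cases auto
next
  case (alice v a w z)
  have u: "unique_edge P v (a x)"
    using P alice.prems(1) alice.hyps(1) by (auto simp: is_protocol_def dest!: bspec)
  have w: "w \<in> nodes P"
    using P alice.hyps(2) by (auto simp: is_protocol_def rooted_tree_def)
  from alice.prems(2) alice.hyps(1) obtain w' where
    "(v, w') \<in> edges P" "edge_lab P (v, w') = a x" "outputs_from P x y w' z'"
    by cases auto
  with u alice.hyps have "w' = w" unfolding unique_edge_def by blast
  with \<open>outputs_from P x y w' z'\<close> show ?case using alice.IH w by blast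
next
  case (bob v b w z)
  have u: "unique_edge P v (b y)"
    using P bob.prems(1) bob.hyps(1) by (auto simp: is_protocol_def dest!: bspec)
  have w: "w \<in> nodes P"
    using P bob.hyps(2) by (auto simp: is_protocol_def rooted_tree_def)
  from bob.prems(2) bob.hyps(1) obtain w' where
    "(v, w') \<in> edges P" "edge_lab P (v, w') = b y" "outputs_from P x y w' z'"
    by cases auto
  with u bob.hyps have "w' = w" unfolding unique_edge_def by blast
  with \<open>outputs_from P x y w' z'\<close> show ?case using bob.IH w by blast
qed

lemma outputs_from_step:
  assumes P: "is_protocol P" and v: "v \<in> nodes P" and no: "\<nexists>z. outputs_from P x y v z"
  shows "\<exists>w. (v, w) \<in> edges P \<and> w \<in> nodes P \<and> (\<nexists>z. outputs_from P x y w z)"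
proof -
  have *: "\<exists>w. (v, w) \<in> edges P \<and> edge_lab P (v, w) = n \<and> w \<in> nodes P"
    if "unique_edge P v n" for n
    using that P by (auto simp: is_protocol_def rooted_tree_def unique_edge_def)
  show ?thesis
  proof (cases "node_lab P v")
    case (Alice a)
    then have "unique_edge P v (a x)"
      using P v by (auto simp: is_protocol_def dest!: bspec)
    with * Alice no show ?thesis by (meson outputs_from.alice)
  next
    case (Bob b)
    then have "unique_edge P v (b y)"
      using P v by (auto simp: is_protocol_def dest!: bspec)
    with * Bob no show ?thesis by (meson outputs_from.bob)
  next
    case (Output z)
    with no show ?thesis by (meson outputs_from.leaf)
  qed
qed

lemma outputs_from_root_ex1:
  assumes P: "is_protocol P"
  shows "\<exists>!z. outputs_from P x y (root_node P) z"
proof -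
  have r: "root_node P \<in> nodes P"
    using P by (simp add: is_protocol_def rooted_tree_def)
  have "\<exists>z. outputs_from P x y (root_node P) z"
  proof (rule ccontr)
    assume no: "\<nexists>z. outputs_from P x y (root_node P) z"
    define B where "B v \<longleftrightarrow> v \<in> nodes P \<and> (\<nexists>z. outputs_from P x y v z)" for v
    define s where "s v = (SOME w. (v, w) \<in> edges P \<and> B w)" for v
    have s: "(v, s v) \<in> edges P \<and> B (s v)" if "B v" for v
    proof -
      have "\<exists>w. (v, w) \<in> edges P \<and> B w"
        using that outputs_from_step[OF P] unfolding B_def by blast
      then show ?thesis unfolding s_def by (rule someI_ex)
    qed
    have B: "B ((s ^^ i) (root_node P))" for i
      by (induction i) (use r no s in \<open>auto simp: B_def\<close>)
    have "infinite_branch (edges P) (root_node P) (\<lambda>i. (s ^^ i) (root_node P))"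
      using s[OF B] by (simp add: infinite_branch_def)
    with P show False by (auto simp: is_protocol_def)
  qed
  with outputs_from_unique[OF P _ r] show ?thesis by blast
qed

text \<open>
  HOL cannot quantify over types inside a definition, so the type in which the tree nodes live
  is a parameter.
\<close>

definition has_communication_protocol ::
  "'v itself \<Rightarrow> ('x \<Rightarrow> 'y \<Rightarrow> 'z::countable) \<Rightarrow> bool" where
  "has_communication_protocol _ f \<longleftrightarrow>
     (\<exists>P :: ('v, 'x, 'y, 'z) protocol. is_protocol P \<and> protocol_fun P = f)"

definition DISJ :: "(nat \<Rightarrow> bool) \<Rightarrow> (nat \<Rightarrow> bool) \<Rightarrow> bool" where
  "DISJ x y \<longleftrightarrow> (\<forall>i. (x i \<and> y i) = False)"

end

theory Submission
  imports Defs
begin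

text \<open>
  The proof is the fooling set argument, with cardinality in place of a bound on the number of bits.
  The computation on an input follows a finite path, and a tree with countably many nodes has only
  countably many finite paths.  The inputs that follow a given path form a rectangle
  (\<open>output_path_mix\<close>): each edge of the path constrains only \<open>x\<close> or only \<open>y\<close>.  If \<open>DISJ\<close> had a
  protocol, then some path would be shared by two of the uncountably many inputs consisting of
  a set and its complement, say \<open>(x, -x)\<close> and \<open>(x', -x')\<close>.  The mixed inputs \<open>(x, -x')\<close> and
  \<open>(x', -x)\<close> then follow this path too, and hence also give output 1, which says \<open>x \<subseteq> x'\<close> and
  \<open>x' \<subseteq> x\<close>, so \<open>x = x'\<close>.
\<close>

text \<open>
  The path omits its start node \<open>v\<close>.  Keeping all later nodes, and not just the leaf, means that
  two inputs with equal paths make the same choice at every step, with no appeal to the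
  uniqueness of parents in the tree.
\<close>

inductive output_path ::
  "('v, 'x, 'y, 'z) protocol \<Rightarrow> 'x \<Rightarrow> 'y \<Rightarrow> 'z \<Rightarrow> 'v \<Rightarrow> 'v list \<Rightarrow> bool"
  for P x y z where
  leaf: "node_lab P v = Output z \<Longrightarrow> output_path P x y z v []"
| alice: "node_lab P v = Alice a \<Longrightarrow> (v, w) \<in> edges P \<Longrightarrow> edge_lab P (v, w) = a x \<Longrightarrow>
    output_path P x y z w p \<Longrightarrow> output_path P x y z v (w # p)"
| bob: "node_lab P v = Bob b \<Longrightarrow> (v, w) \<in> edges P \<Longrightarrow> edge_lab P (v, w) = b y \<Longrightarrow>
    output_path P x y z w p \<Longrightarrow> output_path P x y z v (w # p)"

lemma outputs_from_iff_output_path: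
  "outputs_from P x y v z \<longleftrightarrow> (\<exists>p. output_path P x y z v p)"
proof
  show "\<exists>p. output_path P x y z v p" if "outputs_from P x y v z"
    using that by (induction rule: outputs_from.induct) (blast intro: output_path.intros)+
next
  have "outputs_from P x y v z" if "output_path P x y z v p" for p
    using that by (induction rule: output_path.induct) (blast intro: outputs_from.intros)+
  then show "outputs_from P x y v z" if "\<exists>p. output_path P x y z v p"
    using that by blast
qed

lemma output_path_in_nodes:
  assumes "output_path P x y z v p" and "edges P \<subseteq> nodes P \<times> nodes P"
  shows "p \<in> lists (nodes P)"
  using assms by (induction rule: output_path.induct) auto

text \<open>
  At Alice's nodes the mixed input behaves like the first input and at Bob's nodes like the
  second; since both follow the same edge, so does the mixed one.
\<close>

lemma output_path_mix:
  assumes "output_path P x y z v p" and "output_path P x' y' z v p"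
  shows "output_path P x y' z v p"
  using assms
proof (induction rule: output_path.induct)
  case (leaf v)
  then show ?case by (blast intro: output_path.leaf)
next
  case (alice v a w p)
  from alice.prems have "output_path P x' y' z w p"
    by cases auto
  with alice show ?case by (blast intro: output_path.alice)
next
  case (bob v b w p)
  from bob.prems bob.hyps(1) have "output_path P x' y' z w p" "edge_lab P (v, w) = b y'"
    by (cases; auto)+
  with bob show ?case by (blast intro: output_path.bob)
qed

lemma protocol_fun_eq_iff_output_path:
  assumes "is_protocol P"
  shows "protocol_fun P x y = z \<longleftrightarrow> (\<exists>p. output_path P x y z (root_node P) p)"
  using outputs_from_root_ex1[OF assms, of x y]
  unfolding protocol_fun_def outputs_from_iff_output_path[symmetric]
  by (metis the_equality)

text \<open>
  The path on an input is injective on a fooling set: two members with a common path would put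
  both mixed inputs on that path as well, and so give them the output \<open>z\<close>.
\<close>

lemma countable_fooling_set:
  assumes P: "is_protocol P"
    and val: "\<And>x y. (x, y) \<in> S \<Longrightarrow> protocol_fun P x y = z"
    and fool: "\<And>x y x' y'. (x, y) \<in> S \<Longrightarrow> (x', y') \<in> S \<Longrightarrow>
      protocol_fun P x y' = z \<Longrightarrow> protocol_fun P x' y = z \<Longrightarrow> (x, y) = (x', y')"
  shows "countable S"
proof -
  let ?path = "\<lambda>x y. output_path P x y z (root_node P)"
  define path where "path = (\<lambda>(x, y). SOME p. ?path x y p)"
  have path: "?path x y (path (x, y))" if "(x, y) \<in> S" for x y
    using val[OF that] unfolding protocol_fun_eq_iff_output_path[OF P] path_def
    by (simp add: someI_ex)
  have "inj_on path S"
  proof (rule inj_onI, clarify)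
    fix x y x' y'
    assume S: "(x, y) \<in> S" "(x', y') \<in> S" and eq: "path (x, y) = path (x', y')"
    have "protocol_fun P x y' = z" "protocol_fun P x' y = z"
      unfolding protocol_fun_eq_iff_output_path[OF P]
      using output_path_mix path[OF S(1)] path[OF S(2)] eq by metis+
    with fool S show "x = x' \<and> y = y'" by blast
  qed
  moreover have "path ` S \<subseteq> lists (nodes P)"
    using path output_path_in_nodes P by (fastforce simp: is_protocol_def rooted_tree_def)
  moreover have "countable (lists (nodes P))"
    using P by (simp add: is_protocol_def)
  ultimately show ?thesis
    by (meson countable_image_inj_on countable_subset)
qed

lemma uncountable_binary_sequences: "uncountable (UNIV :: (nat \<Rightarrow> bool) set)"
proof
  assume "countable (UNIV :: (nat \<Rightarrow> bool) set)"
  then obtain e :: "nat \<Rightarrow> nat \<Rightarrow> bool" where "range e = UNIV"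
    using range_from_nat_into by blast
  then obtain n where "e n = (\<lambda>i. \<not> e i i)"
    by (metis UNIV_I imageE)
  then show False by metis
qed

theorem mainTheorem13:
  "\<not> has_communication_protocol TYPE('v) DISJ"
proof
  assume "has_communication_protocol TYPE('v) DISJ"
  then obtain P :: "('v, nat \<Rightarrow> bool, nat \<Rightarrow> bool, bool) protocol"
    where P: "is_protocol P" and f: "protocol_fun P = DISJ"
    unfolding has_communication_protocol_def by blast
  let ?pair = "\<lambda>x :: nat \<Rightarrow> bool. (x, \<lambda>i. \<not> x i)"
  have "countable (range ?pair)"
    by (rule countable_fooling_set[OF P, where z = True]) (auto simp: f DISJ_def fun_eq_iff)
  moreover have "inj ?pair"
    by (auto intro: injI)
  ultimately show False
    using uncountable_binary_sequences by (blast dest: countable_image_inj_on)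
qed

end
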